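(* Let $\gamma>0$, let $\mathcal Z\subseteq\mathbb R^d$ be a nonempty compact convex set, and let $a=1$. Fix $\bm x$. Suppose that $\mathbb E_{\bm y\sim\mathbb P_{\bm y|\bm x}}[\|\bm y\|_2]<\infty$ and that the (conditional) distribution of $\bm y$ admits a density that is positive on an open set containing $2\bar{\bm y}+\gamma\mathcal Z$ and is centrally symmetric about its mean $\bar{\bm y}:=\mathbb E_{\bm y\sim\mathbb P_{\bm y|\bm x}}[\bm y]$. Then $2\bar{\bm y}\in\mathcal Y^\star_{\mathcal{RSPO}_+}$. Furthermore, if the interior of $\mathcal Z$ is nonempty, then $\mathcal Y^\star_{\mathcal{RSPO}_+}=\{2\bar{\bm y}\}$.
   Context: $\mathbb P_{\bm y|\bm x}$ is a probability distribution on $\mathbb R^d$. $v^\star(\bm y)=\min_{\bm z\in\mathcal Z}\bm y^\top\bm z$; $\bm z^\star_\gamma(\bm y)$ is the unique minimizer of $\bm y^\top\bm z+\frac{\gamma}{2}\|\bm z\|_2^2$ over $\bm z\in\mathcal Z$. The $\mathcal{RSPO}_+$ loss with parameter $a>0$ is $\ell_{\mathcal{RSPO}_+}(\hat{\bm y},\bm y)=\max_{\bm z\in\mathcal Z}\{\bm y^\top\bm z-a\hat{\bm y}^\top\bm z-\frac{a\gamma}{2}\|\bm z\|_2^2\}+a\{\bm z^\star_\gamma(\bm y)^\top\hat{\bm y}+\frac{\gamma}{2}\|\bm z^\star_\gamma(\bm y)\|_2^2\}-v^\star(\bm y)$, and $\mathcal Y^\star_{\mathcal{RSPO}_+}=\operatorname{argmin}_{\hat{\bm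 y}\in\mathbb R^d}\mathbb E_{\bm y\sim\mathbb P_{\bm y|\bm x}}[\ell_{\mathcal{RSPO}_+}(\hat{\bm y},\bm y)]$. *)

theory Defs
  imports "HOL-Probability.Probability"
begin

(* Maxima and minima of values over Z are written as suprema and infima: Max and Min of the
   library are meant for finite sets.  For nonempty compact Z the objectives below are continuous
   on Z, so the bounds are attained. *)

definition opt_value :: "(real ^ 'n) set \<Rightarrow> real ^ 'n \<Rightarrow> real" where
  "opt_value Z y = (INF z\<in>Z. y \<bullet> z)"

(* For Z nonempty, compact and convex and \<gamma> > 0 the objective is strictly convex, so the
   minimizer exists and is unique. *)
definition reg_minimizer :: "real \<Rightarrow> (real ^ 'n) set \<Rightarrow> real ^ 'n \<Rightarrow> real ^ 'n" where
  "reg_minimizer \<gamma> Z y =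
     (THE z. is_arg_min (\<lambda>z. y \<bullet> z + \<gamma> / 2 * (norm z)\<^sup>2) (\<lambda>z. z \<in> Z) z)"

definition rspo_plus_loss ::
    "real \<Rightarrow> real \<Rightarrow> (real ^ 'n) set \<Rightarrow> real ^ 'n \<Rightarrow> real ^ 'n \<Rightarrow> real" where
  "rspo_plus_loss a \<gamma> Z yhat y =
     (SUP z\<in>Z. y \<bullet> z - a * (yhat \<bullet> z) - a * \<gamma> / 2 * (norm z)\<^sup>2)
     + a * (reg_minimizer \<gamma> Z y \<bullet> yhat + \<gamma> / 2 * (norm (reg_minimizer \<gamma> Z y))\<^sup>2)
     - opt_value Z y"

(* For Z nonempty, compact and convex and \<gamma> > 0, the loss is continuous in y and bounded by
   C * (1 + norm y), hence integrable whenever M has a finite first moment; the convention that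
   the integral of a non-integrable function is 0 is then irrelevant. *)
definition rspo_plus_risk ::
    "real \<Rightarrow> real \<Rightarrow> (real ^ 'n) set \<Rightarrow> (real ^ 'n) measure \<Rightarrow> real ^ 'n \<Rightarrow> real" where
  "rspo_plus_risk a \<gamma> Z M yhat = (LINT y|M. rspo_plus_loss a \<gamma> Z yhat y)"

definition rspo_plus_argmin ::
    "real \<Rightarrow> real \<Rightarrow> (real ^ 'n) set \<Rightarrow> (real ^ 'n) measure \<Rightarrow> (real ^ 'n) set" where
  "rspo_plus_argmin a \<gamma> Z M =
     {yhat. is_arg_min (rspo_plus_risk a \<gamma> Z M) (\<lambda>w. w \<in> UNIV) yhat}"

end

theory Submission
  imports Defs
begin

text \<open>
  Let \<open>g w\<close> be the maximum of \<open>w \<bullet> z - \<gamma> / 2 * (norm z)\<^sup>2\<close> over \<open>Z\<close>, attained at the projection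
  \<open>p w\<close> of \<open>w / \<gamma>\<close> onto \<open>Z\<close>.  Up to a term independent of \<open>yhat\<close>, the loss is
  \<open>g (y - yhat) + p (- y) \<bullet> yhat\<close>, and \<open>p\<close> is a subgradient of the convex function \<open>g\<close>.  The
  reflection \<open>y \<mapsto> 2 ybar - y\<close> preserves the distribution, so \<open>p (y - 2 ybar)\<close> and \<open>p (- y)\<close> have
  the same mean, and the expected subgradient inequality at \<open>2 ybar\<close> says that \<open>2 ybar\<close> minimizes
  the risk.  Another minimizer \<open>yhat\<close> would make the subgradient inequality an equality for
  almost all \<open>y\<close>, but at \<open>y = 2 ybar + \<gamma> z\<close> with \<open>z\<close> interior to \<open>Z\<close> it is strict, as a small
  step from \<open>z\<close> in the direction \<open>2 ybar - yhat\<close> shows.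
\<close>

text \<open>Completing the square: for \<open>\<gamma> > 0\<close>,
  \<open>w \<bullet> z - \<gamma> / 2 * (norm z)\<^sup>2\<close> and
  \<open>- \<gamma> / 2 * (norm (z - w /\<^sub>R \<gamma>))\<^sup>2\<close> differ by a term
  independent of \<open>z\<close>. The form as a projection makes continuity in \<open>w\<close> and
  the obtuse-angle inequality available.\<close>

definition reg_maximizer :: "real \<Rightarrow> 'a set \<Rightarrow> 'a \<Rightarrow> 'a :: euclidean_space" where
  "reg_maximizer \<gamma> Z w = closest_point Z (w /\<^sub>R \<gamma>)"

text \<open>For \<open>\<gamma> > 0\<close> and nonempty compact convex \<open>Z\<close> this is the
  convex conjugate of the quadratic penalty restricted to \<open>Z\<close>. Writing it through the
  maximizer instead of a supremum lets integrability in \<open>w\<close> be read off from the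
  maximizer.\<close>

definition reg_support :: "real \<Rightarrow> 'a set \<Rightarrow> 'a :: euclidean_space \<Rightarrow> real" where
  "reg_support \<gamma> Z w =
     w \<bullet> reg_maximizer \<gamma> Z w - \<gamma> / 2 * (norm (reg_maximizer \<gamma> Z w))\<^sup>2"

lemma reg_maximizer_in:
  assumes "compact Z" "Z \<noteq> {}"
  shows "reg_maximizer \<gamma> Z w \<in> Z"
  unfolding reg_maximizer_def using assms by (intro closest_point_in_set compact_imp_closed)

lemma continuous_on_reg_maximizer:
  assumes "compact Z" "convex Z" "Z \<noteq> {}"
  shows "continuous_on UNIV (reg_maximizer \<gamma> Z)"
proof -
  have "continuous_on UNIV (closest_point Z \<circ> (\<lambda>w. w /\<^sub>R \<gamma>))"
    using assms
    by (intro continuous_on_compose continuous_on_closest_point compact_imp_closed continuous_intros)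
  then show ?thesis
    by (simp add: reg_maximizer_def[abs_def] comp_def)
qed

text \<open>Expand the objective around the projection \<open>p\<close>: the linear term is
  \<open>(w - \<gamma> *\<^sub>R p) \<bullet> (z - p)\<close>, which is at most 0 by the
  obtuse-angle property. The quadratic remainder is kept because it gives uniqueness of the
  maximizer.\<close>

lemma reg_objective_le:
  assumes "\<gamma> > 0" "compact Z" "convex Z" "z \<in> Z"
  shows "w \<bullet> z - \<gamma> / 2 * (norm z)\<^sup>2
           \<le> reg_support \<gamma> Z w - \<gamma> / 2 * (norm (z - reg_maximizer \<gamma> Z w))\<^sup>2"
proof -
  define p where "p = reg_maximizer \<gamma> Z w"
  have "(w /\<^sub>R \<gamma> - p) \<bullet> (z - p) \<le> 0"
    unfolding p_def reg_maximizer_def using assms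
    by (intro closest_point_dot compact_imp_closed)
  then have "\<gamma> * ((w /\<^sub>R \<gamma> - p) \<bullet> (z - p)) \<le> 0"
    using assms(1) by (simp add: mult_le_0_iff)
  also have "\<gamma> * ((w /\<^sub>R \<gamma> - p) \<bullet> (z - p)) = (w - \<gamma> *\<^sub>R p) \<bullet> (z - p)"
    using assms(1) by (simp add: inner_diff_left field_simps)
  finally show ?thesis
    unfolding reg_support_def p_def[symmetric] power2_norm_eq_inner
    by (simp add: inner_diff_left inner_diff_right inner_commute algebra_simps)
qed

lemma reg_objective_le_support:
  assumes "\<gamma> > 0" "compact Z" "convex Z" "z \<in> Z"
  shows "w \<bullet> z - \<gamma> / 2 * (norm z)\<^sup>2 \<le> reg_support \<gamma> Z w"
proof -
  have "0 \<le> \<gamma> / 2 * (norm (z - reg_maximizer \<gamma> Z w))\<^sup>2"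
    using assms(1) by simp
  with reg_objective_le[OF assms, of w] show ?thesis
    by linarith
qed

lemma SUP_reg_objective:
  assumes "\<gamma> > 0" "compact Z" "convex Z" "Z \<noteq> {}"
  shows "(SUP z\<in>Z. w \<bullet> z - \<gamma> / 2 * (norm z)\<^sup>2) = reg_support \<gamma> Z w"
proof (rule cSup_eq_maximum)
  show "reg_support \<gamma> Z w \<in> (\<lambda>z. w \<bullet> z - \<gamma> / 2 * (norm z)\<^sup>2) ` Z"
    unfolding reg_support_def using reg_maximizer_in[OF assms(2,4)] by blast
qed (use assms reg_objective_le_support in blast)

text \<open>A sign change turns minimization at \<open>y\<close> into maximization at
  \<open>- y\<close>. The quadratic slack in \<open>reg_objective_le\<close> forces every other
  minimizer to coincide with \<open>p\<close>, as the definite description requires.\<close>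

lemma reg_minimizer_eq:
  assumes "\<gamma> > 0" "compact Z" "convex Z" "Z \<noteq> {}"
  shows "reg_minimizer \<gamma> Z y = reg_maximizer \<gamma> Z (- y)"
proof -
  define p where "p = reg_maximizer \<gamma> Z (- y)"
  define F where "F = (\<lambda>z. y \<bullet> z + \<gamma> / 2 * (norm z)\<^sup>2)"
  have p: "p \<in> Z"
    unfolding p_def using assms by (intro reg_maximizer_in)
  have F: "F p + \<gamma> / 2 * (norm (z - p))\<^sup>2 \<le> F z" if "z \<in> Z" for z
    using reg_objective_le[OF assms(1-3) that, of "- y"]
    unfolding reg_support_def p_def[symmetric] F_def by simp
  have "(THE z. is_arg_min F (\<lambda>z. z \<in> Z) z) = p"
  proof (rule the_equality)
    have "F p \<le> F z" if "z \<in> Z" for z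
    proof -
      have "0 \<le> \<gamma> / 2 * (norm (z - p))\<^sup>2"
        using assms(1) by simp
      with F[OF that] show ?thesis
        by linarith
    qed
    then show "is_arg_min F (\<lambda>z. z \<in> Z) p"
      using p by (auto simp: is_arg_min_linorder)
  next
    fix z
    assume "is_arg_min F (\<lambda>z. z \<in> Z) z"
    then have z: "z \<in> Z" and "F z \<le> F p"
      using p by (auto simp: is_arg_min_linorder)
    with F[OF z] have "\<gamma> / 2 * (norm (z - p))\<^sup>2 \<le> 0"
      by linarith
    then show "z = p"
      using assms(1) by (simp add: mult_le_0_iff)
  qed
  then show ?thesis
    unfolding reg_minimizer_def F_def p_def .
qed

text \<open>The maximizer for \<open>w\<close> is still a competitor for \<open>w + h\<close>, and
  its objective value grows by exactly its inner product with \<open>h\<close>.\<close>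

lemma reg_support_subgradient:
  assumes "\<gamma> > 0" "compact Z" "convex Z" "Z \<noteq> {}"
  shows "reg_support \<gamma> Z w + reg_maximizer \<gamma> Z w \<bullet> h \<le> reg_support \<gamma> Z (w + h)"
proof -
  have "reg_maximizer \<gamma> Z w \<in> Z"
    using assms by (intro reg_maximizer_in)
  from reg_objective_le_support[OF assms(1-3) this, of "w + h"] show ?thesis
    by (simp add: reg_support_def[of _ _ w] inner_add_left inner_commute)
qed

text \<open>At \<open>\<gamma> *\<^sub>R z\<close> the maximizer is \<open>z\<close> itself. After
  the shift by \<open>h\<close>, the competitor \<open>z + t *\<^sub>R h\<close> exceeds the
  subgradient bound by \<open>t * (1 - \<gamma> * t / 2) * (h \<bullet> h)\<close>.\<close>

lemma reg_support_subgradient_strict: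
  assumes "\<gamma> > 0" "compact Z" "convex Z" and z: "z \<in> interior Z" and "h \<noteq> 0"
  shows "reg_support \<gamma> Z (\<gamma> *\<^sub>R z) + reg_maximizer \<gamma> Z (\<gamma> *\<^sub>R z) \<bullet> h
           < reg_support \<gamma> Z (\<gamma> *\<^sub>R z + h)"
proof -
  have "z \<in> Z"
    using z interior_subset by blast
  then have p: "reg_maximizer \<gamma> Z (\<gamma> *\<^sub>R z) = z"
    using assms(1) by (simp add: reg_maximizer_def closest_point_self)
  obtain e where e: "e > 0" "cball z e \<subseteq> Z"
    using z by (auto simp: mem_interior_cball)
  \<comment> \<open>The first bound keeps \<open>z + t *\<^sub>R h\<close> in the ball inside
    \<open>Z\<close>; the second keeps \<open>1 - \<gamma> * t / 2\<close> at least 1/2.\<close>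
  define t where "t = min (e / norm h) (1 / \<gamma>)"
  have "t > 0" "t \<le> 1 / \<gamma>" "t \<le> e / norm h"
    using e assms by (auto simp: t_def)
  then have t: "t > 0" "\<gamma> * t \<le> 1" "t * norm h \<le> e"
    using assms by (auto simp: field_simps)
  then have "z + t *\<^sub>R h \<in> cball z e"
    by (simp add: dist_norm)
  with e(2) have "z + t *\<^sub>R h \<in> Z"
    by blast
  then have "(\<gamma> *\<^sub>R z + h) \<bullet> (z + t *\<^sub>R h) - \<gamma> / 2 * (norm (z + t *\<^sub>R h))\<^sup>2
      \<le> reg_support \<gamma> Z (\<gamma> *\<^sub>R z + h)"
    using assms by (intro reg_objective_le_support)
  moreover have "(\<gamma> *\<^sub>R z + h) \<bullet> (z + t *\<^sub>R h) - \<gamma> / 2 * (norm (z + t *\<^sub>R h))\<^sup>2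
      = \<gamma> / 2 * (z \<bullet> z) + z \<bullet> h + t * (1 - \<gamma> * t / 2) * (h \<bullet> h)"
    unfolding power2_norm_eq_inner
    by (simp add: inner_add_left inner_add_right inner_commute algebra_simps)
  moreover have "t * (1 - \<gamma> * t / 2) * (h \<bullet> h) > 0"
    using t assms(5) by (intro mult_pos_pos) auto
  ultimately show ?thesis
    by (simp add: reg_support_def[of _ _ "\<gamma> *\<^sub>R z"] p power2_norm_eq_inner)
qed

text \<open>An infimum of linear functions whose slopes are bounded in norm by \<open>B\<close> is
  \<open>B\<close>-Lipschitz.\<close>

lemma continuous_on_opt_value:
  assumes "compact Z" "Z \<noteq> {}"
  shows "continuous_on UNIV (opt_value Z)"
proof -
  obtain B where "B > 0" and B: "\<And>z. z \<in> Z \<Longrightarrow> norm z \<le> B"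
    using compact_imp_bounded[OF assms(1)] by (auto simp: bounded_pos)
  have bdd: "bdd_below ((\<lambda>z. y \<bullet> z) ` Z)" for y
    using assms by (intro bounded_imp_bdd_below compact_imp_bounded compact_continuous_image
        continuous_intros)
  have le: "opt_value Z x - opt_value Z y \<le> B * dist x y" for x y
  proof -
    have "opt_value Z x - B * dist x y \<le> opt_value Z y"
      unfolding opt_value_def[of _ y]
    proof (rule cINF_greatest[OF assms(2)])
      fix z
      assume z: "z \<in> Z"
      then have "opt_value Z x \<le> x \<bullet> z"
        unfolding opt_value_def by (intro cINF_lower bdd)
      also have "\<dots> = y \<bullet> z + (x - y) \<bullet> z"
        by (simp add: inner_diff_left)
      also have "(x - y) \<bullet> z \<le> norm (x - y) * norm z"
        by (rule norm_cauchy_schwarz)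
      also have "\<dots> \<le> norm (x - y) * B"
        using B[OF z] by (intro mult_left_mono) auto
      finally show "opt_value Z x - B * dist x y \<le> y \<bullet> z"
        by (simp add: dist_norm mult.commute)
    qed
    then show ?thesis
      by simp
  qed
  have "B-lipschitz_on UNIV (opt_value Z)"
  proof (rule lipschitz_onI)
    show "dist (opt_value Z x) (opt_value Z y) \<le> B * dist x y" for x y
      using le[of x y] le[of y x] by (simp add: dist_real_def abs_le_iff dist_commute)
  qed (use \<open>B > 0\<close> in simp)
  then show ?thesis
    by (rule lipschitz_on_continuous_on)
qed

lemma abs_opt_value_le:
  assumes "compact Z" "Z \<noteq> {}" and B: "\<And>z. z \<in> Z \<Longrightarrow> norm z \<le> B"
  shows "\<bar>opt_value Z y\<bar> \<le> B * norm y"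
proof -
  have "\<bar>y \<bullet> z\<bar> \<le> B * norm y" if "z \<in> Z" for z
  proof -
    have "\<bar>y \<bullet> z\<bar> \<le> norm y * norm z"
      by (rule Cauchy_Schwarz_ineq2)
    also have "\<dots> \<le> norm y * B"
      using B[OF that] by (intro mult_left_mono) auto
    finally show ?thesis
      by (simp add: mult.commute)
  qed
  then show ?thesis
    unfolding opt_value_def using assms(2) by (intro cInf_abs_ge) auto
qed

text \<open>Continuity gives measurability, and the finite first moment gives an integrable
  dominating function. All pieces of the loss are handled by this one criterion.\<close>

lemma integrable_continuous_linear_growth:
  fixes h :: "'a :: euclidean_space \<Rightarrow> 'b :: euclidean_space"
  assumes "finite_measure M" "sets M = sets borel" "integrable M (\<lambda>y. norm y)"
    and "continuous_on UNIV h" and bound: "\<And>y. norm (h y) \<le> C + D * norm y"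
  shows "integrable M h"
proof (rule Bochner_Integration.integrable_bound)
  interpret finite_measure M by fact
  show "integrable M (\<lambda>y. C + D * norm y)"
    using assms(3) by simp
  have "h \<in> borel_measurable borel"
    using assms(4) by (rule borel_measurable_continuous_onI)
  then show "h \<in> borel_measurable M"
    by (simp add: measurable_cong_sets[OF assms(2) refl])
  show "AE y in M. norm (h y) \<le> norm (C + D * norm y)"
    using bound by (intro always_eventually) (auto intro: order_trans[OF _ abs_ge_self])
qed

text \<open>Lebesgue measure is invariant under \<open>y \<mapsto> 2 *\<^sub>R c - y\<close>, an
  affine map with factor -1, and \<open>f\<close> is invariant by symmetry, so the change of
  variables leaves the integral unchanged.\<close>

lemma integral_density_reflect:
  fixes f :: "'a :: euclidean_space \<Rightarrow> real" and h :: "'a \<Rightarrow> 'b :: euclidean_space"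
  assumes [measurable]: "f \<in> borel_measurable borel" "h \<in> borel_measurable borel"
    and "\<And>y. f y \<ge> 0" and sym: "\<And>u. f (c + u) = f (c - u)"
  shows "(LINT y|density lborel f. h (2 *\<^sub>R c - y)) = (LINT y|density lborel f. h y)"
proof -
  have refl: "distr lborel borel (\<lambda>y. 2 *\<^sub>R c - y) = (lborel :: 'a measure)"
    using lborel_affine[of "-1" "2 *\<^sub>R c"] by (simp add: density_1)
  have "f (2 *\<^sub>R c - y) = f y" for y
    using sym[of "c - y"] by (simp add: scaleR_2 algebra_simps)
  then have "(LINT y|density lborel f. h (2 *\<^sub>R c - y))
      = (LINT y|lborel. f (2 *\<^sub>R c - y) *\<^sub>R h (2 *\<^sub>R c - y))"
    using assms(3) by (subst integral_density) auto
  also have "\<dots> = (LINT y|distr lborel borel (\<lambda>y. 2 *\<^sub>R c - y). f y *\<^sub>R h y)"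
    by (subst integral_distr) auto
  also have "\<dots> = (LINT y|density lborel f. h y)"
    unfolding refl using assms(3) by (subst integral_density) auto
  finally show ?thesis .
qed

text \<open>Positivity of \<open>f\<close> on \<open>S\<close> turns the almost-sure statement into
  a Lebesgue-almost-everywhere one on \<open>S\<close>. Since a nonempty open set is not negligible,
  \<open>Q\<close> cannot fail on all of \<open>S\<close>.\<close>

lemma AE_density_obtain_point:
  fixes f :: "'a :: euclidean_space \<Rightarrow> real"
  assumes [measurable]: "f \<in> borel_measurable borel" and AE: "AE y in density lborel f. Q y"
    and "open S" "S \<noteq> {}" and pos: "\<And>y. y \<in> S \<Longrightarrow> f y > 0"
  obtains y where "y \<in> S" "Q y"
proof -
  have "AE y in lborel. f y > 0 \<longrightarrow> Q y"
    using AE by (subst (asm) AE_density) auto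
  then have "AE y in lborel. y \<in> S \<longrightarrow> Q y"
    using pos by (auto elim!: eventually_mono)
  moreover have "\<not> (AE y in lborel. y \<notin> S)"
  proof
    assume "AE y in lborel. y \<notin> S"
    then have "emeasure lborel S = 0"
      using assms(3) by (subst (asm) AE_iff_measurable[of S]) auto
    then have "negligible S"
      using assms(3) by (simp add: negligible_iff_null_sets null_sets_def null_sets_completionI)
    then show False
      using open_not_negligible assms(3,4) by blast
  qed
  ultimately have "\<exists>y. y \<in> S \<and> Q y"
    by (metis (mono_tags, lifting) eventually_mono)
  then show thesis
    using that by blast
qed

theorem corollary1:
  fixes \<gamma> a :: real
    and Z U :: "(real ^ 'n) set"
    and P :: "'x \<Rightarrow> (real ^ 'n) measure"
    and x :: 'x
    and f :: "real ^ 'n \<Rightarrow> real"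
    and ybar :: "real ^ 'n"
  assumes "\<gamma> > 0"
    and "Z \<noteq> {}" and "compact Z" and "convex Z"
    and "a = 1"
    and "prob_space (P x)" and "sets (P x) = sets borel"
    and "integrable (P x) (\<lambda>y. norm y)"
    and "ybar = (LINT y|P x. y)"
    and "\<And>y. f y \<ge> 0"
    and "distributed (P x) lborel (\<lambda>y. y) (\<lambda>y. ennreal (f y))"
    and "open U" and "(\<lambda>z. 2 *\<^sub>R ybar + \<gamma> *\<^sub>R z) ` Z \<subseteq> U" and "\<And>y. y \<in> U \<Longrightarrow> f y > 0"
    and "\<And>u. f (ybar + u) = f (ybar - u)"
  shows "2 *\<^sub>R ybar \<in> rspo_plus_argmin a \<gamma> Z (P x) \<and>
         (interior Z \<noteq> {} \<longrightarrow> rspo_plus_argmin a \<gamma> Z (P x) = {2 *\<^sub>R ybar})"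
proof -
  define M where "M = P x"
  define g where "g = reg_support \<gamma> Z"
  define p where "p = reg_maximizer \<gamma> Z"
  define R where "R = rspo_plus_risk a \<gamma> Z M"
  interpret prob_space M
    unfolding M_def by fact
  note setting = \<open>\<gamma> > 0\<close> \<open>compact Z\<close> \<open>convex Z\<close> \<open>Z \<noteq> {}\<close>
  have sets_M: "sets M = sets borel"
    using assms(7) by (simp add: M_def)
  have f[measurable]: "f \<in> borel_measurable borel"
    using distributed_real_measurable[OF _ assms(11)] assms(10) by simp
  \<comment> \<open>The random variable is the identity, so its law is \<open>M\<close> itself, and
    \<open>f\<close> is a density of \<open>M\<close>.\<close>
  have "distr M lborel (\<lambda>y. y) = density lborel f"
    using assms(11) by (simp add: distributed_def M_def)
  moreover have "distr M lborel (\<lambda>y. y) = M"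
    by (rule distr_id2) (simp add: sets_M)
  ultimately have M: "M = density lborel f"
    by simp

  have cont_p: "continuous_on UNIV p"
    unfolding p_def using setting by (intro continuous_on_reg_maximizer)
  note cont_p' = continuous_on_compose2[OF cont_p _ subset_UNIV]
  obtain B where "B > 0" and B: "\<And>z. z \<in> Z \<Longrightarrow> norm z \<le> B"
    using compact_imp_bounded[OF \<open>compact Z\<close>] by (auto simp: bounded_pos)
  have p_B: "norm (p w) \<le> B" for w
    unfolding p_def using setting by (intro B reg_maximizer_in)
  note integrableI = integrable_continuous_linear_growth[OF finite_measure_axioms sets_M
      assms(8)[folded M_def]]
  \<comment> \<open>The parameters cover both arguments that occur: \<open>s = 1\<close>,
    \<open>c = - w\<close> for \<open>y - w\<close>, and \<open>s = -1\<close>, \<open>c = 0\<close>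
    for \<open>- y\<close>.\<close>
  have int_p: "integrable M (\<lambda>y. p (s *\<^sub>R y + c))" for s c
    using p_B by (intro integrableI[where C = B and D = 0] cont_p' continuous_intros) auto
  have int_p2: "integrable M (\<lambda>y. (norm (p (s *\<^sub>R y + c)))\<^sup>2)" for s c
    using p_B by (intro integrableI[where C = "B\<^sup>2" and D = 0] cont_p' continuous_intros)
      (auto intro!: power_mono)
  have int_yp: "integrable M (\<lambda>y. y \<bullet> p (s *\<^sub>R y + c))" for s c
  proof (rule integrableI[where C = 0 and D = B])
    show "norm (y \<bullet> p (s *\<^sub>R y + c)) \<le> 0 + B * norm y" for y
      using Cauchy_Schwarz_ineq2[of y "p (s *\<^sub>R y + c)"] p_B[of "s *\<^sub>R y + c"]
        mult_left_mono[of "norm (p (s *\<^sub>R y + c))" B "norm y"]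
      by (simp add: mult.commute)
  qed (intro cont_p' continuous_intros)
  have int_g: "integrable M (\<lambda>y. g (y - w))" for w
    unfolding g_def reg_support_def p_def[symmetric]
    using int_p[of 1 "- w"] int_p2[of 1 "- w"] int_yp[of 1 "- w"]
    by (auto simp: inner_diff_left)
  have int_pm: "integrable M (\<lambda>y. p (- y))"
    using int_p[of "-1" 0] by simp
  have int_pm2: "integrable M (\<lambda>y. (norm (p (- y)))\<^sup>2)"
    using int_p2[of "-1" 0] by simp
  have int_opt: "integrable M (opt_value Z)"
    using abs_opt_value_le[OF \<open>compact Z\<close> \<open>Z \<noteq> {}\<close> B]
    by (intro integrableI[where C = 0 and D = B] continuous_on_opt_value setting) auto

  define K where "K = (LINT y|M. \<gamma> / 2 * (norm (p (- y)))\<^sup>2 - opt_value Z y)"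
  have R: "R w = (LINT y|M. g (y - w)) + (LINT y|M. p (- y)) \<bullet> w + K" for w
  proof -
    \<comment> \<open>Because \<open>a = 1\<close>, the linear terms in the supremum merge into
      \<open>(y - w) \<bullet> z\<close>, so the supremum is \<open>g (y - w)\<close>. The bracketed
      rest does not depend on \<open>w\<close> and integrates to \<open>K\<close>.\<close>
    have "rspo_plus_loss a \<gamma> Z w
        = (\<lambda>y. g (y - w) + p (- y) \<bullet> w + (\<gamma> / 2 * (norm (p (- y)))\<^sup>2 - opt_value Z y))"
      using SUP_reg_objective[OF setting]
      by (simp add: fun_eq_iff rspo_plus_loss_def \<open>a = 1\<close> reg_minimizer_eq[OF setting] g_def p_def
          flip: inner_diff_left)
    then show ?thesis
      unfolding R_def rspo_plus_risk_def K_def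
      using int_g[of w] int_pm int_pm2 int_opt by simp
  qed

  \<comment> \<open>Reflecting about \<open>ybar\<close> replaces the argument \<open>- y\<close> by
    \<open>- (2 *\<^sub>R ybar - y)\<close>.\<close>
  have mean_p: "(LINT y|M. p (y - 2 *\<^sub>R ybar)) = (LINT y|M. p (- y))"
    using integral_density_reflect[OF f _ assms(10) assms(15), of "\<lambda>y. p (- y)"]
    by (simp add: M borel_measurable_continuous_onI cont_p' continuous_intros)
  \<comment> \<open>The slack of the subgradient inequality for \<open>g\<close> at
    \<open>y - 2 *\<^sub>R ybar\<close>, with step \<open>2 *\<^sub>R ybar - w\<close> leading to
    \<open>y - w\<close>.\<close>
  define gap where "gap = (\<lambda>w y. g (y - w)
      - (g (y - 2 *\<^sub>R ybar) + p (y - 2 *\<^sub>R ybar) \<bullet> (2 *\<^sub>R ybar - w)))"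
  have gap_nonneg: "gap w y \<ge> 0" for w y
    using reg_support_subgradient[OF setting, of "y - 2 *\<^sub>R ybar" "2 *\<^sub>R ybar - w"]
    by (simp add: gap_def g_def p_def)
  have int_p_shift: "integrable M (\<lambda>y. p (y - 2 *\<^sub>R ybar))"
    using int_p[of 1 "- 2 *\<^sub>R ybar"] by simp
  have int_gap: "integrable M (gap w)" for w
    unfolding gap_def using int_g int_p_shift by auto
  \<comment> \<open>By \<open>mean_p\<close> the mean subgradient is the coefficient of
    \<open>w\<close> in \<open>R w\<close>, so the linear terms match and the excess risk is exactly
    the expected gap.\<close>
  have R_gap: "R w - R (2 *\<^sub>R ybar) = (LINT y|M. gap w y)" for w
  proof -
    have "(LINT y|M. gap w y) = (LINT y|M. g (y - w))
        - ((LINT y|M. g (y - 2 *\<^sub>R ybar)) + (LINT y|M. p (y - 2 *\<^sub>R ybar)) \<bullet> (2 *\<^sub>R ybar - w))"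
      unfolding gap_def using int_g int_p_shift by simp
    then show ?thesis
      unfolding R mean_p by (simp add: inner_diff_right)
  qed
  have min: "R (2 *\<^sub>R ybar) \<le> R w" for w
  proof -
    have "(LINT y|M. gap w y) \<ge> 0"
      by (intro Bochner_Integration.integral_nonneg gap_nonneg)
    with R_gap[of w] show ?thesis
      by simp
  qed
  have unique: "w = 2 *\<^sub>R ybar" if "interior Z \<noteq> {}" "R w \<le> R (2 *\<^sub>R ybar)" for w
  proof (rule ccontr)
    assume w: "w \<noteq> 2 *\<^sub>R ybar"
    have "(LINT y|M. gap w y) = 0"
      using R_gap[of w] min[of w] that(2) by simp
    then have "AE y in M. gap w y = 0"
      using integral_nonneg_eq_0_iff_AE[OF int_gap] gap_nonneg by simp
    then have AE: "AE y in density lborel f. gap w y = 0"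
      unfolding M .
    \<comment> \<open>On \<open>S\<close> the point \<open>y - 2 *\<^sub>R ybar\<close> has the form
      \<open>\<gamma> *\<^sub>R z\<close> with \<open>z\<close> interior, where the gap is strictly
      positive. As \<open>S\<close> is open and lies in \<open>U\<close>, where \<open>f\<close> is
      positive, an almost surely vanishing gap is contradicted there.\<close>
    define S where "S = (\<lambda>z. 2 *\<^sub>R ybar + \<gamma> *\<^sub>R z) ` interior Z"
    have "open S"
      unfolding S_def using open_affinity[of "interior Z" \<gamma> "2 *\<^sub>R ybar"] \<open>\<gamma> > 0\<close> by simp
    moreover have "S \<noteq> {}"
      unfolding S_def using that(1) by simp
    moreover have "f y > 0" if "y \<in> S" for y
      using that assms(13,14) interior_subset[of Z] unfolding S_def by blast
    ultimately obtain y where "y \<in> S" "gap w y = 0"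
      using AE_density_obtain_point[OF f AE] by metis
    then obtain z where z: "z \<in> interior Z" and y: "y = 2 *\<^sub>R ybar + \<gamma> *\<^sub>R z"
      unfolding S_def by blast
    have "gap w y > 0"
      using reg_support_subgradient_strict[OF setting(1-3) z, of "2 *\<^sub>R ybar - w"] w
      by (simp add: gap_def g_def p_def y algebra_simps)
    with \<open>gap w y = 0\<close> show False
      by simp
  qed
  have "rspo_plus_argmin a \<gamma> Z M = {w. \<forall>v. R w \<le> R v}"
    by (auto simp: rspo_plus_argmin_def is_arg_min_linorder R_def)
  with min unique show ?thesis
    unfolding M_def[symmetric] by blast
qed

end
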